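(* Let $0\le\lambda\le1$ and $|\epsilon|=1$. Let $f=h+\overline{g}$ be harmonic in $\mathbb{D}$, where $h(z)=z+\sum_{n=2}^{\infty}a_nz^n$ and $g(z)=\sum_{n=2}^{\infty}b_nz^n$, and suppose that for all $n\ge 2$ $$|a_n|\le \frac{n+1}{2},\qquad |b_n|\le \frac{n-1}{2}.$$ Then the radius of fully starlikeness for $F(z)=(1-\lambda)f+\lambda D_f^{\epsilon}$ is at least $r_c$, where $r_c$ is the root in the interval $(0,1)$ of the equation $$1-4(2+\lambda) r+(13-2 \lambda ) r^2-8 r^3+2 r^4=0 .$$ The result is sharp.
   Context: $\mathbb{D}=\{z\in\mathbb{C}:|z|<1\}$. $\mathcal{H}$ is the class of complex-valued harmonic functions $f=h+\overline g$ on $\mathbb{D}$ with $h,g$ analytic in $\mathbb{D}$, $h(0)=g(0)=0$, $h'(0)=1$. $\mathcal{S}_H$ is the class of univalent sense-preserving $f\in\mathcal{H}$ (sense-preserving: $|g'(z)|<|h'(z)|$ in $\mathbb{D}$). For $f=h+\overline g$ and $|\epsilon|=1$, $D_f^{\epsilon}(z)=zf_z-\epsilon\,\overline z f_{\overline z}=zh'(z)-\epsilon\,\overline{zg'(z)}$. A function $F\in\mathcal{S}_H$ is fully starlike (in $\mathbb{D}$) if it maps every circle $|z|=r<1$ in a one-to-one manner onto a curve satisfying $\frac{\partial}{\partial\theta}\arg F(re^{i\theta})>0$ for $0\le\theta<2\pi$, $0<r<1$. $F$ is fully starlike in $|z|<r$ ($0<r<1$) if $F_r(z)=r^{-1}F(rz)$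 is fully starlike in $\mathbb{D}$. The radius of fully starlikeness being at least $\rho$ means that $F$ is fully starlike in $|z|<\rho$ for every $f$ satisfying the hypotheses. "Sharp" means that, for given $\lambda$, the radius cannot be replaced by a larger number with the conclusion still holding for all data ($f$ and $\epsilon$) allowed by the hypotheses. *)

theory Defs
  imports "HOL-Complex_Analysis.Complex_Analysis"
begin

abbreviation unit_disk :: "complex set" where
  "unit_disk \<equiv> ball 0 1"

text \<open>All notions below depend only on the values of the functions on the open unit disk.\<close>

definition harmonic_rep ::
    "(complex \<Rightarrow> complex) \<Rightarrow> (complex \<Rightarrow> complex) \<Rightarrow> (complex \<Rightarrow> complex) \<Rightarrow> bool" where
  "harmonic_rep f h g \<longleftrightarrow>
     h holomorphic_on unit_disk \<and> g holomorphic_on unit_disk \<and>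
     h 0 = 0 \<and> g 0 = 0 \<and> deriv h 0 = 1 \<and>
     (\<forall>z\<in>unit_disk. f z = h z + cnj (g z))"

definition class_SH :: "(complex \<Rightarrow> complex) set" where
  "class_SH = {f. inj_on f unit_disk \<and>
     (\<exists>h g. harmonic_rep f h g \<and> (\<forall>z\<in>unit_disk. norm (deriv g z) < norm (deriv h z)))}"

text \<open>The Wirtinger derivatives \<open>f\<^sub>z = (f\<^sub>x - \<i> f\<^sub>y) / 2\<close> and \<open>(f\<^sub>x + \<i> f\<^sub>y) / 2\<close>,
  where \<open>f\<^sub>x\<close> and \<open>f\<^sub>y\<close> are the values of the real derivative of \<open>f\<close> in the
  directions \<open>1\<close> and \<open>\<i>\<close>.\<close>

definition wirtinger_z :: "(complex \<Rightarrow> complex) \<Rightarrow> complex \<Rightarrow> complex" where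
  "wirtinger_z f z =
     (frechet_derivative f (at z) 1 - \<i> * frechet_derivative f (at z) \<i>) / 2"

definition wirtinger_zbar :: "(complex \<Rightarrow> complex) \<Rightarrow> complex \<Rightarrow> complex" where
  "wirtinger_zbar f z =
     (frechet_derivative f (at z) 1 + \<i> * frechet_derivative f (at z) \<i>) / 2"

definition D_op :: "complex \<Rightarrow> (complex \<Rightarrow> complex) \<Rightarrow> complex \<Rightarrow> complex" where
  "D_op \<epsilon> f z = z * wirtinger_z f z - \<epsilon> * cnj z * wirtinger_zbar f z"

lemma D_op_harmonic_rep:
  assumes "harmonic_rep f h g" and z: "z \<in> unit_disk"
  shows "D_op \<epsilon> f z = z * deriv h z - \<epsilon> * cnj (z * deriv g z)"
proof -
  from assms have hol: "h holomorphic_on unit_disk" "g holomorphic_on unit_disk"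
    and eq: "\<And>w. w \<in> unit_disk \<Longrightarrow> f w = h w + cnj (g w)"
    by (auto simp: harmonic_rep_def)
  have dh: "(h has_derivative (*) (deriv h z)) (at z)"
    and dg: "(g has_derivative (*) (deriv g z)) (at z)"
    using holomorphic_derivI[OF hol(1) open_ball z] holomorphic_derivI[OF hol(2) open_ball z]
    by (simp_all add: has_field_derivative_def)
  have "((\<lambda>w. h w + cnj (g w)) has_derivative (\<lambda>w. deriv h z * w + cnj (deriv g z * w))) (at z)"
    by (intro has_derivative_add dh bounded_linear.has_derivative[OF bounded_linear_cnj dg])
  then have "(f has_derivative (\<lambda>w. deriv h z * w + cnj (deriv g z * w))) (at z)"
    by (rule has_derivative_transform_within_open[OF _ open_ball z]) (simp add: eq)
  then have "frechet_derivative f (at z) = (\<lambda>w. deriv h z * w + cnj (deriv g z * w))"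
    by (rule frechet_derivative_at[symmetric])
  then show ?thesis
    by (simp add: D_op_def wirtinger_z_def wirtinger_zbar_def algebra_simps)
qed

text \<open>The derivative at \<open>t\<close> of the argument along the curve \<open>c\<close> is \<open>d\<close>. The argument is
  only defined up to multiples of \<open>2 * pi\<close>, and only off the origin; a determination \<open>\<phi>\<close> of
  it near \<open>t\<close> that is differentiable at \<open>t\<close> has a derivative that does not depend on its choice.\<close>

definition has_arg_derivative :: "(real \<Rightarrow> complex) \<Rightarrow> real \<Rightarrow> real \<Rightarrow> bool" where
  "has_arg_derivative c d t \<longleftrightarrow> c t \<noteq> 0 \<and>
     (\<exists>\<phi>. (\<forall>\<^sub>F s in nhds t. c s = of_real (norm (c s)) * cis (\<phi> s)) \<and>
          (\<phi> has_real_derivative d) (at t))"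

definition fully_starlike :: "(complex \<Rightarrow> complex) \<Rightarrow> bool" where
  "fully_starlike F \<longleftrightarrow> F \<in> class_SH \<and>
     (\<forall>r. 0 < r \<and> r < 1 \<longrightarrow>
        inj_on F (sphere 0 r) \<and>
        (\<forall>\<theta>. 0 \<le> \<theta> \<and> \<theta> < 2 * pi \<longrightarrow>
           (\<exists>d>0. has_arg_derivative (\<lambda>t. F (of_real r * cis t)) d \<theta>)))"

definition fully_starlike_in :: "(complex \<Rightarrow> complex) \<Rightarrow> real \<Rightarrow> bool" where
  "fully_starlike_in F r \<longleftrightarrow> fully_starlike (\<lambda>z. F (of_real r * z) / of_real r)"

definition convex_coeff_bounds :: "(complex \<Rightarrow> complex) \<Rightarrow> bool" where
  "convex_coeff_bounds f \<longleftrightarrow> (\<exists>h g (a :: nat \<Rightarrow> complex) (b :: nat \<Rightarrow> complex).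
     harmonic_rep f h g \<and>
     (\<forall>z\<in>unit_disk. (\<lambda>n. a (n + 2) * z ^ (n + 2)) sums (h z - z)) \<and>
     (\<forall>z\<in>unit_disk. (\<lambda>n. b (n + 2) * z ^ (n + 2)) sums g z) \<and>
     (\<forall>n\<ge>2. norm (a n) \<le> (real n + 1) / 2 \<and> norm (b n) \<le> (real n - 1) / 2))"

definition D_combination ::
    "real \<Rightarrow> complex \<Rightarrow> (complex \<Rightarrow> complex) \<Rightarrow> complex \<Rightarrow> complex" where
  "D_combination l \<epsilon> f z = (1 - of_real l) * f z + of_real l * D_op \<epsilon> f z"

end

theory Submission
  imports Defs
begin

text \<open>
  Write \<open>f = h + cnj g\<close>. The combination is again harmonic, \<open>F = H + cnj G\<close>, where \<open>H\<close> has the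
  coefficients \<open>(1 - \<lambda> + \<lambda> n) a\<^sub>n\<close> and \<open>G\<close> the coefficients \<open>(1 - \<lambda> - \<lambda> cnj \<epsilon> n) b\<^sub>n\<close>. After the
  dilatation by \<open>r\<close>, the \<open>n\<close>-th coefficients \<open>\<alpha>\<^sub>n, \<beta>\<^sub>n\<close> carry a factor \<open>r\<^bsup>n-1\<^esup>\<close>, so the hypotheses give
  \<open>\<Sum>\<^sub>n\<^sub>\<ge>\<^sub>2 n (|\<alpha>\<^sub>n| + |\<beta>\<^sub>n|) \<le> S(r) - 1\<close> with
  \<open>S(r) = \<Sum>\<^sub>n\<^sub>\<ge>\<^sub>1 n\<^sup>2 (1 - \<lambda> + \<lambda> n) r\<^bsup>n-1\<^esup>\<close>, a strictly increasing function of \<open>r\<close> which has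
  the closed form \<open>coeff_majorant\<close>. The quartic of the theorem is \<open>(1 - r)\<^sup>4 (2 - S(r))\<close>, so its only root
  in the unit interval is the point where \<open>S = 2\<close>.

  The condition \<open>\<Sum> n (|\<alpha>\<^sub>n| + |\<beta>\<^sub>n|) \<le> 1\<close> makes \<open>F\<close> fully starlike (locale \<open>small_coefficients\<close>),
  because \<open>F\<close> is then a small perturbation of the identity: \<open>F - id\<close> is a strict contraction on every
  smaller disk, which yields injectivity and preservation of orientation, and the Euler derivative
  \<open>D = z H' - cnj (z G')\<close> satisfies \<open>|D - F| < |D + F|\<close>, that is, \<open>Re (D / F) > 0\<close>. The latter real part
  is the speed of the argument of \<open>F\<close> along a circle.

  For sharpness, take all \<open>a\<^sub>n = -(n + 1)/2\<close>, all \<open>b\<^sub>n = (n - 1)/2\<close> and \<open>\<epsilon> = -1\<close>. Then \<open>H' - G' = 2 - S\<close> on the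
  interval \<open>(0, 1)\<close>, so at the critical radius \<open>H' = G'\<close> and \<open>F\<close> is not sense-preserving on any larger disk
  (\<open>extremal_not_fully_starlike_in\<close>).
\<close>

section \<open>Power series\<close>

text \<open>Two series are bounded against one joint majorant, since below only the combined weight
  \<open>n (|\<alpha>\<^sub>n| + |\<beta>\<^sub>n|)\<close> is controlled.\<close>

lemma norm_sums_add_le:
  fixes x y :: "nat \<Rightarrow> 'a::banach"
  assumes "x sums X" "y sums Y" "m sums M"
    and le: "\<And>n. norm (x n) + norm (y n) \<le> m n"
  shows "norm X + norm Y \<le> M"
proof -
  have xm: "norm (norm (x n)) \<le> m n" and ym: "norm (norm (y n)) \<le> m n" for n
    using le[of n] norm_ge_zero[of "x n"] norm_ge_zero[of "y n"]
    unfolding real_norm_def abs_norm_cancel by linarith+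
  have m: "summable m"
    using assms(3) by (rule sums_summable)
  have sx: "summable (\<lambda>n. norm (x n))" and sy: "summable (\<lambda>n. norm (y n))"
    by (rule summable_comparison_test'[OF m, of 0], rule xm)
      (rule summable_comparison_test'[OF m, of 0], rule ym)
  have "norm X \<le> (\<Sum>n. norm (x n))" "norm Y \<le> (\<Sum>n. norm (y n))"
    using summable_norm[OF sx] summable_norm[OF sy] assms(1,2) by (simp_all add: sums_iff)
  moreover have "(\<Sum>n. norm (x n)) + (\<Sum>n. norm (y n)) \<le> M"
    using suminf_add[OF sx sy] suminf_le[OF le summable_add[OF sx sy] m] assms(3)
    by (simp add: sums_iff)
  ultimately show ?thesis by linarith
qed

lemma power_series_derivative_sums:
  fixes c :: "nat \<Rightarrow> 'a::{real_normed_field,banach}"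
  assumes sums: "\<And>w. norm w < 1 \<Longrightarrow> (\<lambda>n. c n * w ^ n) sums f w"
    and f': "(f has_field_derivative f') (at z)" and z: "norm z < 1"
  shows "(\<lambda>n. of_nat n * c n * z ^ (n - 1)) sums f'"
proof -
  have summ: "\<And>w. norm w < 1 \<Longrightarrow> summable (\<lambda>n. c n * w ^ n)"
    using sums by (blast intro: sums_summable)
  have "((\<lambda>w. \<Sum>n. c n * w ^ n) has_field_derivative (\<Sum>n. diffs c n * z ^ n)) (at z)"
    by (rule termdiffs_strong'[OF summ z])
  then have "(f has_field_derivative (\<Sum>n. diffs c n * z ^ n)) (at z)"
    by (rule has_field_derivative_transform_within_open[of _ _ _ "ball 0 1"])
      (use z sums in \<open>auto simp: sums_iff\<close>)
  then have "f' = (\<Sum>n. diffs c n * z ^ n)"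
    by (rule DERIV_unique[OF f'])
  then show ?thesis
    using diffs_equiv[OF termdiff_converges[OF z summ]] by simp
qed

lemma power_series_euler_sums:
  fixes c :: "nat \<Rightarrow> 'a::{real_normed_field,banach}"
  assumes sums: "\<And>w. norm w < 1 \<Longrightarrow> (\<lambda>n. c n * w ^ n) sums f w"
    and f': "(f has_field_derivative f') (at z)" and z: "norm z < 1"
  shows "(\<lambda>n. of_nat n * c n * z ^ n) sums (z * f')"
proof -
  have "(\<lambda>n. z * (of_nat n * c n * z ^ (n - 1))) sums (z * f')"
    by (intro sums_mult power_series_derivative_sums[OF assms])
  moreover have "(\<lambda>n. z * (of_nat n * c n * z ^ (n - 1))) = (\<lambda>n. of_nat n * c n * z ^ n)"
  proof
    show "z * (of_nat n * c n * z ^ (n - 1)) = of_nat n * c n * z ^ n" for n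
      by (cases n) (simp_all add: algebra_simps)
  qed
  ultimately show ?thesis by simp
qed

text \<open>The sums of \<open>n z\<^sup>n\<close>, \<open>n\<^sup>2 z\<^sup>n\<close> and \<open>n\<^sup>3 z\<^sup>n\<close> arise from the geometric series by applying the Euler
  operator \<open>z d/dz\<close> again and again; the first of them is the Koebe function \<open>z / (1 - z)\<^sup>2\<close>.\<close>

lemma koebe_deriv:
  fixes z :: "'a::{real_normed_field}"
  assumes "z \<noteq> 1"
  shows "((\<lambda>w. w / (1 - w)\<^sup>2) has_field_derivative (1 + z) / (1 - z) ^ 3) (at z)"
proof -
  have "1 - z \<noteq> 0" using assms by auto
  then show ?thesis
    by (auto intro!: derivative_eq_intros simp: divide_simps) algebra
qed

lemma koebe_euler_deriv:
  fixes z :: "'a::{real_normed_field}"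
  assumes "z \<noteq> 1"
  shows "((\<lambda>w. w * ((1 + w) / (1 - w) ^ 3)) has_field_derivative
    (1 + 4 * z + z\<^sup>2) / (1 - z) ^ 4) (at z)"
proof -
  have "1 - z \<noteq> 0" using assms by auto
  then show ?thesis
    by (auto intro!: derivative_eq_intros simp: divide_simps) algebra
qed

lemma
  fixes z :: "'a::{real_normed_field,banach}"
  assumes z: "norm z < 1"
  shows sums_of_nat_powers: "(\<lambda>n. of_nat n * z ^ n) sums (z / (1 - z)\<^sup>2)" (is ?A)
    and sums_square_powers: "(\<lambda>n. of_nat n ^ 2 * z ^ n) sums (z * ((1 + z) / (1 - z) ^ 3))" (is ?B)
    and sums_cube_powers: "(\<lambda>n. of_nat n ^ 3 * z ^ n) sums (z * ((1 + 4 * z + z\<^sup>2) / (1 - z) ^ 4))" (is ?C)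
proof -
  have 1: "(\<lambda>n. of_nat n * w ^ n) sums (w / (1 - w)\<^sup>2)" if w: "norm w < 1" for w :: 'a
  proof -
    have "w \<noteq> 1" using w by auto
    then have "((\<lambda>w. 1 / (1 - w)) has_field_derivative 1 / (1 - w)\<^sup>2) (at w)"
      by (auto intro!: derivative_eq_intros simp: field_simps power2_eq_square)
    from power_series_euler_sums[of "\<lambda>_. 1", OF _ this w] show ?thesis
      by (simp add: geometric_sums)
  qed
  have 2: "(\<lambda>n. of_nat n ^ 2 * w ^ n) sums (w * ((1 + w) / (1 - w) ^ 3))" if w: "norm w < 1" for w :: 'a
  proof -
    have "w \<noteq> 1" using w by auto
    from power_series_euler_sums[OF 1 koebe_deriv[OF this] w] show ?thesis
      by (simp add: power2_eq_square)
  qed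
  have "z \<noteq> 1" using z by auto
  from power_series_euler_sums[OF 2 koebe_euler_deriv[OF this] z] show ?C
    by (simp add: power2_eq_square power3_eq_cube mult.assoc)
  show ?A ?B using 1 2 z by blast+
qed

section \<open>Derivative of the argument along a curve\<close>

text \<open>Dividing by the value at \<open>t\<close> moves the curve to the point 1, near which the principal logarithm is a
  differentiable choice of the argument.\<close>

lemma has_arg_derivativeI:
  assumes c': "(c has_vector_derivative c') (at t)" and nz: "c t \<noteq> 0"
  shows "has_arg_derivative c (Im (c' / c t)) t"
proof -
  define \<phi> where "\<phi> s = Im (Ln (c s / c t)) + Arg (c t)" for s
  have "c s = of_real (norm (c s)) * cis (\<phi> s)" for s
  proof (cases "c s = 0")
    case False
    with nz have "c s / c t \<noteq> 0" by simp
    then have "cis (\<phi> s) = sgn (c s / c t) * sgn (c t)"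
      using nz by (simp add: \<phi>_def cis_Arg flip: cis_mult Arg_eq_Im_Ln)
    also have "\<dots> = sgn (c s)"
      using nz by (metis nonzero_eq_divide_eq sgn_mult)
    finally show ?thesis
      using False by (simp add: sgn_eq)
  qed simp
  moreover have "(\<phi> has_real_derivative Im (c' / c t)) (at t)"
  proof -
    have "((\<lambda>s. c s / c t) has_vector_derivative c' / c t) (at t)"
      by (rule bounded_linear.has_vector_derivative[OF bounded_linear_divide c'])
    moreover have "(Ln has_field_derivative inverse (c t / c t)) (at (c t / c t))"
      using nz by (intro has_field_derivative_Ln) auto
    ultimately have "((Ln \<circ> (\<lambda>s. c s / c t)) has_vector_derivative c' / c t * inverse (c t / c t)) (at t)"
      by (rule field_vector_diff_chain_at)
    then have "((\<lambda>s. Ln (c s / c t)) has_vector_derivative c' / c t) (at t)"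
      using nz by (simp add: o_def)
    from bounded_linear.has_vector_derivative[OF bounded_linear_Im this]
    have "((\<lambda>s. Im (Ln (c s / c t))) has_real_derivative Im (c' / c t)) (at t)"
      by (simp add: has_real_derivative_iff_has_vector_derivative)
    then show ?thesis
      unfolding \<phi>_def by (intro DERIV_add[OF _ DERIV_const, simplified])
  qed
  ultimately show ?thesis
    unfolding has_arg_derivative_def using nz by (intro conjI exI[of _ \<phi>] always_eventually allI)
qed

section \<open>A coefficient condition for full starlikeness\<close>

lemma Re_mult_cnj_pos:
  assumes "norm (a - b) < norm (a + b)"
  shows "0 < Re (a * cnj b)"
proof -
  have "(norm (a - b))\<^sup>2 < (norm (a + b))\<^sup>2"
    using assms by (intro power_strict_mono) auto
  moreover have "(norm (a + b))\<^sup>2 - (norm (a - b))\<^sup>2 = 4 * Re (a * cnj b)"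
    unfolding cmod_power2 by (simp add: power2_eq_square algebra_simps)
  ultimately show ?thesis by linarith
qed

text \<open>The sum \<open>M\<close> is a parameter so that the weighted series can be compared with a majorant whose sum
  is known. Coefficients with index below 2 vanish, so only powers \<open>|z|\<^sup>n \<le> |z|\<^sup>2\<close> occur in the estimates;
  compared with the leading term \<open>z\<close> this gains a factor \<open>|z| < 1\<close>, which turns the weak bound \<open>M \<le> 1\<close>
  into strict inequalities.\<close>

locale small_coefficients =
  fixes F H G :: "complex \<Rightarrow> complex" and \<alpha> \<beta> :: "nat \<Rightarrow> complex" and M :: real
  assumes rep: "harmonic_rep F H G"
    and H_sums: "\<And>z. norm z < 1 \<Longrightarrow> (\<lambda>n. \<alpha> n * z ^ n) sums (H z - z)"
    and G_sums: "\<And>z. norm z < 1 \<Longrightarrow> (\<lambda>n. \<beta> n * z ^ n) sums G z"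
    and low: "\<And>n. n < 2 \<Longrightarrow> \<alpha> n = 0 \<and> \<beta> n = 0"
    and M_sums: "(\<lambda>n. real n * (norm (\<alpha> n) + norm (\<beta> n))) sums M"
    and M_le: "M \<le> 1"
begin

lemma F_eq: "norm z < 1 \<Longrightarrow> F z = H z + cnj (G z)"
  using rep by (simp add: harmonic_rep_def)

lemma deriv_H: "norm z < 1 \<Longrightarrow> (H has_field_derivative deriv H z) (at z)"
  and deriv_G: "norm z < 1 \<Longrightarrow> (G has_field_derivative deriv G z) (at z)"
  using rep by (auto simp: harmonic_rep_def intro!: holomorphic_derivI[of _ "ball 0 1"])

lemma deriv_remainder:
  "norm z < 1 \<Longrightarrow> ((\<lambda>w. H w - w) has_field_derivative deriv H z - 1) (at z)"
  by (intro derivative_intros deriv_H)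

lemma deriv_bound:
  assumes z: "norm z < 1"
  shows "norm (deriv H z - 1) + norm (deriv G z) \<le> norm z"
proof -
  have "norm (deriv H z - 1) + norm (deriv G z) \<le> norm z * M"
  proof (rule norm_sums_add_le)
    show "(\<lambda>n. of_nat n * \<alpha> n * z ^ (n - 1)) sums (deriv H z - 1)"
      by (rule power_series_derivative_sums[OF H_sums deriv_remainder[OF z] z])
    show "(\<lambda>n. of_nat n * \<beta> n * z ^ (n - 1)) sums deriv G z"
      by (rule power_series_derivative_sums[OF G_sums deriv_G[OF z] z])
    show "(\<lambda>n. norm z * (real n * (norm (\<alpha> n) + norm (\<beta> n)))) sums (norm z * M)"
      by (intro sums_mult M_sums)
    show "norm (of_nat n * \<alpha> n * z ^ (n - 1)) + norm (of_nat n * \<beta> n * z ^ (n - 1))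
      \<le> norm z * (real n * (norm (\<alpha> n) + norm (\<beta> n)))" for n
    proof (cases "n < 2")
      case False
      then have "norm z ^ (n - 1) \<le> norm z ^ 1"
        using z by (intro power_decreasing) auto
      then have "norm z ^ (n - 1) * (real n * (norm (\<alpha> n) + norm (\<beta> n)))
        \<le> norm z * (real n * (norm (\<alpha> n) + norm (\<beta> n)))"
        by (intro mult_right_mono) auto
      then show ?thesis
        by (simp add: norm_mult norm_power algebra_simps)
    qed (simp add: low)
  qed
  also have "\<dots> \<le> norm z"
    using M_le by (simp add: mult_left_le)
  finally show ?thesis .
qed

lemma sense_preserving:
  assumes z: "norm z < 1"
  shows "norm (deriv G z) < norm (deriv H z)"
proof -
  have "1 \<le> norm (deriv H z - 1) + norm (deriv H z)"
    using norm_triangle_ineq4[of "deriv H z" "deriv H z - 1"] by simp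
  then show ?thesis
    using deriv_bound[OF z] z by linarith
qed

text \<open>On the disk of radius \<open>s < 1\<close> the map \<open>F - id\<close> is Lipschitz with constant \<open>s\<close>, so two points with the
  same image under \<open>F\<close> must coincide.\<close>

lemma inj_on_disk: "inj_on F (ball 0 1)"
proof (rule inj_onI)
  fix z w
  assume z: "z \<in> ball 0 (1::real)" and w: "w \<in> ball 0 1" and eq: "F z = F w"
  define s where "s = max (norm z) (norm w)"
  have s: "s < 1" using z w by (simp add: s_def)
  have "norm ((F z - z) - (F w - w)) \<le> s * norm (z - w)"
  proof (rule differentiable_bound)
    show "convex (cball (0::complex) s)" by simp
    show "z \<in> cball 0 s" "w \<in> cball 0 s" by (auto simp: s_def)
  next
    fix x :: complex
    assume "x \<in> cball 0 s"
    then have x: "norm x \<le> s" "norm x < 1" using s by auto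
    have "((\<lambda>w. (H w - w) + cnj (G w)) has_derivative
        (\<lambda>v. (deriv H x - 1) * v + cnj (deriv G x * v))) (at x)"
      using deriv_remainder[OF x(2)] deriv_G[OF x(2)]
      unfolding has_field_derivative_def
      by (intro has_derivative_add bounded_linear.has_derivative[OF bounded_linear_cnj])
    then have "((\<lambda>w. F w - w) has_derivative (\<lambda>v. (deriv H x - 1) * v + cnj (deriv G x * v))) (at x)"
      by (rule has_derivative_transform_within_open[of _ _ _ _ "ball 0 1"])
        (use x in \<open>auto simp: F_eq\<close>)
    then show "((\<lambda>w. F w - w) has_derivative (\<lambda>v. (deriv H x - 1) * v + cnj (deriv G x * v)))
        (at x within cball 0 s)"
      by (rule has_derivative_at_withinI)
    show "onorm (\<lambda>v. (deriv H x - 1) * v + cnj (deriv G x * v)) \<le> s"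
    proof (rule onorm_le)
      fix v
      have "norm ((deriv H x - 1) * v + cnj (deriv G x * v))
        \<le> norm ((deriv H x - 1) * v) + norm (deriv G x * v)"
        by (metis complex_mod_cnj norm_triangle_ineq)
      also have "\<dots> = (norm (deriv H x - 1) + norm (deriv G x)) * norm v"
        by (simp only: norm_mult distrib_right)
      also have "\<dots> \<le> s * norm v"
        using deriv_bound[OF x(2)] x(1) by (intro mult_right_mono) auto
      finally show "norm ((deriv H x - 1) * v + cnj (deriv G x * v)) \<le> s * norm v" .
    qed
  qed
  with eq have "norm (z - w) \<le> s * norm (z - w)"
    by (simp add: norm_minus_commute)
  with s show "z = w"
    by (metis eq_iff_diff_eq_0 linorder_not_le mult.commute mult_less_cancel_left2 norm_eq_zero norm_ge_zero order_less_le)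
qed

text \<open>In both \<open>D + F - 2 z\<close> and \<open>D - F\<close> the linear terms cancel. The coefficient \<open>\<alpha>\<^sub>n\<close> enters them with the
  factors \<open>n + 1\<close> and \<open>n - 1\<close>, the coefficient \<open>\<beta>\<^sub>n\<close> with \<open>n - 1\<close> and \<open>n + 1\<close>, so that in the sum of the two
  norms each has the weight \<open>2 n\<close>, exactly the one that is controlled.\<close>

lemma argument_increasing:
  assumes z: "norm z < 1" "z \<noteq> 0"
  shows "0 < Re ((z * deriv H z - cnj (z * deriv G z)) * cnj (F z))"
proof (rule Re_mult_cnj_pos)
  define D where "D = z * deriv H z - cnj (z * deriv G z)"
  note Hs = H_sums[OF z(1)] power_series_euler_sums[OF H_sums deriv_remainder[OF z(1)] z(1)]
  note Gs = G_sums[OF z(1)] power_series_euler_sums[OF G_sums deriv_G[OF z(1)] z(1)]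
  let ?N = "\<lambda>n. of_nat n :: complex"
  let ?A = "\<lambda>n. \<alpha> n * z ^ n" and ?B = "\<lambda>n. \<beta> n * z ^ n"
  let ?x = "\<lambda>n. (?N n + 1) * ?A n - (?N n - 1) * cnj (?B n)"
  let ?y = "\<lambda>n. (?N n - 1) * ?A n - (?N n + 1) * cnj (?B n)"
  have "norm (D + F z - 2 * z) + norm (D - F z) \<le> 2 * (norm z)\<^sup>2 * M"
  proof (rule norm_sums_add_le)
    have "(\<lambda>n. (?N n * \<alpha> n * z ^ n + ?A n) - (cnj (?N n * \<beta> n * z ^ n) - cnj (?B n)))
        sums (z * (deriv H z - 1) + (H z - z) - (cnj (z * deriv G z) - cnj (G z)))"
      using Hs Gs by (intro sums_add sums_diff iffD2[OF sums_cnj])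
    then show "?x sums (D + F z - 2 * z)"
      by (simp add: D_def F_eq[OF z(1)] algebra_simps)
    have "(\<lambda>n. (?N n * \<alpha> n * z ^ n - ?A n) - (cnj (?N n * \<beta> n * z ^ n) + cnj (?B n)))
        sums (z * (deriv H z - 1) - (H z - z) - (cnj (z * deriv G z) + cnj (G z)))"
      using Hs Gs by (intro sums_add sums_diff iffD2[OF sums_cnj])
    then show "?y sums (D - F z)"
      by (simp add: D_def F_eq[OF z(1)] algebra_simps)
    show "(\<lambda>n. 2 * (norm z)\<^sup>2 * (real n * (norm (\<alpha> n) + norm (\<beta> n)))) sums (2 * (norm z)\<^sup>2 * M)"
      by (intro sums_mult M_sums)
    show "norm (?x n) + norm (?y n) \<le> 2 * (norm z)\<^sup>2 * (real n * (norm (\<alpha> n) + norm (\<beta> n)))" for n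
    proof (cases "n < 2")
      case False
      then have zn: "norm z ^ n \<le> (norm z)\<^sup>2"
        using z by (intro power_decreasing) auto
      have n: "norm (?N n + 1) = real n + 1" "norm (?N n - 1) = real n - 1"
        using False norm_of_nat[of "n + 1", where 'a = complex]
          norm_of_nat[of "n - 1", where 'a = complex]
        by (simp_all add: of_nat_diff add.commute)
      have "norm (?x n) + norm (?y n)
        \<le> (norm ((?N n + 1) * ?A n) + norm ((?N n - 1) * cnj (?B n)))
          + (norm ((?N n - 1) * ?A n) + norm ((?N n + 1) * cnj (?B n)))"
        by (intro add_mono norm_triangle_ineq4)
      also have "\<dots> = norm z ^ n * (2 * (real n * (norm (\<alpha> n) + norm (\<beta> n))))"
        unfolding norm_mult n complex_mod_cnj norm_power by (simp add: algebra_simps)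
      also have "\<dots> \<le> (norm z)\<^sup>2 * (2 * (real n * (norm (\<alpha> n) + norm (\<beta> n))))"
        using zn by (intro mult_right_mono) auto
      finally show ?thesis by (simp add: algebra_simps)
    qed (simp add: low)
  qed
  also have "\<dots> \<le> 2 * (norm z)\<^sup>2"
    using M_le by (simp add: mult_left_le)
  also have "\<dots> < 2 * norm z"
    using z by (simp add: power2_eq_square)
  finally have "norm (D - F z) < 2 * norm z - norm (D + F z - 2 * z)" by linarith
  also have "\<dots> \<le> norm (D + F z)"
    using norm_triangle_ineq4[of "D + F z" "D + F z - 2 * z"] by (simp add: norm_mult)
  finally show "norm (D - F z) < norm (D + F z)" .
qed

theorem fully_starlike: "fully_starlike F"
  unfolding fully_starlike_def
proof (intro conjI allI impI)
  show "F \<in> class_SH"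
    unfolding class_SH_def mem_Collect_eq
    using inj_on_disk rep sense_preserving by (intro conjI exI[of _ H] exI[of _ G]) auto
next
  fix r :: real
  assume r: "0 < r \<and> r < 1"
  then have "sphere (0::complex) r \<subseteq> ball 0 1" by auto
  then show "inj_on F (sphere 0 r)"
    using inj_on_disk inj_on_subset by blast
  fix \<theta> :: real
  define z where "z = of_real r * cis \<theta>"
  have z: "norm z < 1" "z \<noteq> 0" using r by (auto simp: z_def norm_mult)
  define D where "D = z * deriv H z - cnj (z * deriv G z)"
  have pos: "0 < Re (D * cnj (F z))"
    unfolding D_def by (rule argument_increasing[OF z])
  then have nz: "F z \<noteq> 0" by auto
  have circle: "((\<lambda>t. of_real r * cis t) has_vector_derivative \<i> * z) (at \<theta>)"
    by (auto intro!: derivative_eq_intros simp: z_def has_vector_derivative_def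
        algebra_simps scaleR_conv_of_real)
  have "(H \<circ> (\<lambda>t. of_real r * cis t) has_vector_derivative \<i> * z * deriv H z) (at \<theta>)"
    "(G \<circ> (\<lambda>t. of_real r * cis t) has_vector_derivative \<i> * z * deriv G z) (at \<theta>)"
    using circle deriv_H[OF z(1)] deriv_G[OF z(1)] unfolding z_def
    by (blast intro: field_vector_diff_chain_at)+
  then have "((\<lambda>t. H (of_real r * cis t) + cnj (G (of_real r * cis t))) has_vector_derivative
      \<i> * z * deriv H z + cnj (\<i> * z * deriv G z)) (at \<theta>)"
    unfolding o_def
    by (intro has_vector_derivative_add bounded_linear.has_vector_derivative[OF bounded_linear_cnj])
  moreover have "F (of_real r * cis t) = H (of_real r * cis t) + cnj (G (of_real r * cis t))" for t
    using r by (intro F_eq) (simp add: norm_mult)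
  ultimately have "((\<lambda>t. F (of_real r * cis t)) has_vector_derivative \<i> * D) (at \<theta>)"
    by (simp add: D_def algebra_simps)
  from has_arg_derivativeI[OF this] nz
  have "has_arg_derivative (\<lambda>t. F (of_real r * cis t)) (Im (\<i> * D / F z)) \<theta>"
    by (simp add: z_def)
  moreover have "Im (\<i> * D / F z) = Re (D / F z)"
    by (simp add: Im_divide Re_divide field_simps)
  ultimately show "\<exists>d>0. has_arg_derivative (\<lambda>t. F (of_real r * cis t)) d \<theta>"
    using pos Re_complex_div_gt_0[of D "F z"] by auto
qed

end

section \<open>The combination of a harmonic map with its Euler derivative\<close>

lemma D_combination_rep:
  assumes rep: "harmonic_rep f h g" and \<rho>: "0 < \<rho>" "\<rho> \<le> 1"
  shows "harmonic_rep (\<lambda>z. D_combination l \<epsilon> f (of_real \<rho> * z) / of_real \<rho>)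
    (\<lambda>z. ((1 - of_real l) * h (of_real \<rho> * z)
        + of_real l * (of_real \<rho> * z * deriv h (of_real \<rho> * z))) / of_real \<rho>)
    (\<lambda>z. ((1 - of_real l) * g (of_real \<rho> * z)
        - of_real l * cnj \<epsilon> * (of_real \<rho> * z * deriv g (of_real \<rho> * z))) / of_real \<rho>)"
proof -
  have h: "h holomorphic_on ball 0 1" "h 0 = 0" "deriv h 0 = 1"
    and g: "g holomorphic_on ball 0 1" "g 0 = 0"
    and f: "\<And>w. w \<in> ball 0 1 \<Longrightarrow> f w = h w + cnj (g w)"
    using rep by (auto simp: harmonic_rep_def)
  have in_disk: "of_real \<rho> * z \<in> ball (0::complex) 1" if "z \<in> ball 0 1" for z
  proof -
    have "norm (of_real \<rho> * z) \<le> 1 * norm z"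
      unfolding norm_mult using \<rho> by (intro mult_right_mono) auto
    then show ?thesis using that by simp
  qed
  have dilate: "(\<lambda>z. u (of_real \<rho> * z)) holomorphic_on ball 0 1"
    if "u holomorphic_on ball 0 1" for u :: "complex \<Rightarrow> complex"
    using holomorphic_on_compose_gen[of "\<lambda>z. of_real \<rho> * z" "ball 0 1" u "ball 0 1"] that in_disk
    by (simp add: o_def image_subset_iff holomorphic_intros)
  have h': "deriv h holomorphic_on ball 0 1" and g': "deriv g holomorphic_on ball 0 1"
    using h g by (auto intro: holomorphic_deriv)
  have "((\<lambda>w. (1 - of_real l) * h w + of_real l * (w * deriv h w)) has_field_derivative
      (1 - of_real l) * deriv h 0 + of_real l * (1 * deriv h 0 + 0 * deriv (deriv h) 0)) (at (of_real \<rho> * 0))"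
    using holomorphic_derivI[OF h(1) open_ball, of 0] holomorphic_derivI[OF h' open_ball, of 0]
    by (auto intro!: derivative_eq_intros)
  then have "((\<lambda>w. (1 - of_real l) * h w + of_real l * (w * deriv h w)) has_field_derivative 1)
      (at (of_real \<rho> * 0))"
    using h(3) by simp
  from DERIV_chain2[where g = "\<lambda>z. of_real \<rho> * z" and x = 0, OF this DERIV_cmult_Id]
  have "((\<lambda>z. (1 - of_real l) * h (of_real \<rho> * z)
        + of_real l * (of_real \<rho> * z * deriv h (of_real \<rho> * z))) has_field_derivative of_real \<rho>) (at 0)"
    by simp
  from DERIV_cdivide[OF this, of "of_real \<rho>"] \<rho>
  have "deriv (\<lambda>z. ((1 - of_real l) * h (of_real \<rho> * z)
        + of_real l * (of_real \<rho> * z * deriv h (of_real \<rho> * z))) / of_real \<rho>) 0 = 1"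
    by (intro DERIV_imp_deriv) simp
  moreover have "D_combination l \<epsilon> f w = ((1 - of_real l) * h w + of_real l * (w * deriv h w))
      + cnj ((1 - of_real l) * g w - of_real l * cnj \<epsilon> * (w * deriv g w))" if "w \<in> ball 0 1" for w
    unfolding D_combination_def D_op_harmonic_rep[OF rep that] f[OF that]
    by (simp add: algebra_simps)
  ultimately show ?thesis
    unfolding harmonic_rep_def using h g in_disk \<rho>
    by (auto intro!: holomorphic_intros dilate h' g' simp: add_divide_distrib)
qed

text \<open>The value at \<open>r\<close> of \<open>\<Sum>\<^sub>n\<^sub>\<ge>\<^sub>1 n\<^sup>2 (1 - l + l n) r\<^bsup>n-1\<^esup>\<close>, for \<open>0 < r < 1\<close>, in a closed form from which monotonicity and the
  relation to the quartic polynomial can be read off.\<close>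

definition coeff_majorant :: "real \<Rightarrow> real \<Rightarrow> real" where
  "coeff_majorant l r = (1 - l) * ((1 + r) / (1 - r) ^ 3) + l * ((1 + 4 * r + r\<^sup>2) / (1 - r) ^ 4)"

lemma coeff_majorant_sums:
  assumes r: "0 < r" "r < 1"
  shows "(\<lambda>n. real n ^ 2 * (1 - l + l * real n) * r ^ n / r) sums coeff_majorant l r"
proof -
  have "(\<lambda>n. ((1 - l) * (real n ^ 2 * r ^ n) + l * (real n ^ 3 * r ^ n)) / r) sums
      (((1 - l) * (r * ((1 + r) / (1 - r) ^ 3)) + l * (r * ((1 + 4 * r + r\<^sup>2) / (1 - r) ^ 4))) / r)"
    using r by (intro sums_divide sums_add sums_mult sums_square_powers sums_cube_powers) auto
  also have "((1 - l) * (r * ((1 + r) / (1 - r) ^ 3)) + l * (r * ((1 + 4 * r + r\<^sup>2) / (1 - r) ^ 4))) / r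
      = coeff_majorant l r"
  proof -
    have "((1 - l) * (r * a) + l * (r * b)) / r = (1 - l) * a + l * b" for a b :: real
      using r by (simp add: field_simps)
    then show ?thesis unfolding coeff_majorant_def .
  qed
  also have "(\<lambda>n. ((1 - l) * (real n ^ 2 * r ^ n) + l * (real n ^ 3 * r ^ n)) / r)
      = (\<lambda>n. real n ^ 2 * (1 - l + l * real n) * r ^ n / r)"
    by (simp add: algebra_simps power2_eq_square power3_eq_cube)
  finally show ?thesis .
qed

lemma coeff_majorant_strict_mono:
  assumes l: "0 \<le> l" "l \<le> 1" and r: "0 \<le> r" "r < s" "s < 1"
  shows "coeff_majorant l r < coeff_majorant l s"
proof -
  have 1: "(1 + r) / (1 - r) ^ 3 < (1 + s) / (1 - s) ^ 3"
    using r by (intro frac_less power_mono) auto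
  have "r\<^sup>2 \<le> s\<^sup>2"
    using r by (intro power_mono) auto
  then have "1 + 4 * r + r\<^sup>2 < 1 + 4 * s + s\<^sup>2"
    using r by linarith
  then have 2: "(1 + 4 * r + r\<^sup>2) / (1 - r) ^ 4 < (1 + 4 * s + s\<^sup>2) / (1 - s) ^ 4"
    using r by (intro frac_less power_mono) auto
  show ?thesis
  proof (cases "l = 0")
    case False
    then show ?thesis
      unfolding coeff_majorant_def using 1 2 l
      by (intro add_le_less_mono mult_left_mono mult_strict_left_mono) auto
  qed (use 1 in \<open>simp add: coeff_majorant_def\<close>)
qed

lemma quartic_eq:
  assumes "r < (1::real)"
  shows "1 - 4 * (2 + l) * r + (13 - 2 * l) * r ^ 2 - 8 * r ^ 3 + 2 * r ^ 4
    = (1 - r) ^ 4 * (2 - coeff_majorant l r)"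
proof -
  have "1 - r \<noteq> 0" using assms by simp
  then have "(1 - r) ^ 4 * coeff_majorant l r
      = (1 - l) * ((1 + r) * (1 - r)) + l * (1 + 4 * r + r\<^sup>2)"
    by (simp add: coeff_majorant_def divide_simps) algebra
  moreover have "1 - 4 * (2 + l) * r + (13 - 2 * l) * r ^ 2 - 8 * r ^ 3 + 2 * r ^ 4
      = (1 - r) ^ 4 * 2 - ((1 - l) * ((1 + r) * (1 - r)) + l * (1 + 4 * r + r\<^sup>2))"
    by algebra
  ultimately show ?thesis
    by (simp only: right_diff_distrib)
qed

text \<open>The two coefficient bounds add up to \<open>(n + 1)/2 + (n - 1)/2 = n\<close>, which is where the factor \<open>n\<^sup>2\<close> of the
  majorant comes from. Its term with \<open>n = 1\<close> belongs to the identity and is subtracted.\<close>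

theorem fully_starlike_in_D_combination:
  assumes f: "convex_coeff_bounds f" and \<epsilon>: "norm \<epsilon> = 1" and l: "0 \<le> l" "l \<le> 1"
    and r: "0 < r" "r < 1" "coeff_majorant l r \<le> 2"
  shows "fully_starlike_in (D_combination l \<epsilon> f) r"
proof -
  obtain h g a b where rep: "harmonic_rep f h g"
    and h: "\<And>z. z \<in> ball 0 1 \<Longrightarrow> (\<lambda>n. a (n + 2) * z ^ (n + 2)) sums (h z - z)"
    and g: "\<And>z. z \<in> ball 0 1 \<Longrightarrow> (\<lambda>n. b (n + 2) * z ^ (n + 2)) sums g z"
    and ab: "\<And>n. 2 \<le> n \<Longrightarrow> norm (a n) \<le> (real n + 1) / 2"
      "\<And>n. 2 \<le> n \<Longrightarrow> norm (b n) \<le> (real n - 1) / 2"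
    using f unfolding convex_coeff_bounds_def by blast
  \<comment> \<open>The coefficients below index 2 are unconstrained, hence replaced by 0.\<close>
  define a' b' where "a' n = (if n < 2 then 0 else a n)" and "b' n = (if n < 2 then 0 else b n)" for n
  have h': "(\<lambda>n. a' n * z ^ n) sums (h z - z)" and g': "(\<lambda>n. b' n * z ^ n) sums g z"
    if "norm z < 1" for z
  proof -
    have "(\<lambda>n. a' (n + 2) * z ^ (n + 2)) sums (h z - z)" "(\<lambda>n. b' (n + 2) * z ^ (n + 2)) sums g z"
      using h[of z] g[of z] that by (simp_all add: a'_def b'_def)
    moreover have "a' n * z ^ n = 0" "b' n * z ^ n = 0" if "n < 2" for n
      using that by (simp_all add: a'_def b'_def)
    ultimately show "(\<lambda>n. a' n * z ^ n) sums (h z - z)" "(\<lambda>n. b' n * z ^ n) sums g z"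
      using sums_zero_iff_shift[of 2 "\<lambda>n. a' n * z ^ n"]
        sums_zero_iff_shift[of 2 "\<lambda>n. b' n * z ^ n"] by blast+
  qed
  let ?l = "of_real l :: complex" and ?r = "of_real r :: complex"
  define H G where "H z = ((1 - ?l) * h (?r * z) + ?l * (?r * z * deriv h (?r * z))) / ?r"
    and "G z = ((1 - ?l) * g (?r * z) - ?l * cnj \<epsilon> * (?r * z * deriv g (?r * z))) / ?r" for z
  define \<alpha> \<beta> where "\<alpha> n = (1 - ?l + ?l * of_nat n) * a' n * ?r ^ n / ?r"
    and "\<beta> n = (1 - ?l - ?l * cnj \<epsilon> * of_nat n) * b' n * ?r ^ n / ?r" for n
  have bound: "real n * (norm (\<alpha> n) + norm (\<beta> n))
      \<le> real n ^ 2 * (1 - l + l * real n) * r ^ n / r - (if n = 1 then 1 else 0)" for n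
  proof (cases "n < 2")
    case True
    then consider "n = 0" | "n = 1" by linarith
    then show ?thesis
      using r by cases (simp_all add: \<alpha>_def \<beta>_def a'_def b'_def)
  next
    case False
    define k where "k = 1 - l + l * real n"
    have k: "0 \<le> k" using l by (simp add: k_def)
    have "norm (1 - ?l + ?l * of_nat n) = k"
      using k norm_of_real[of k, where 'a = complex] by (simp add: k_def)
    then have "norm (\<alpha> n) = k * norm (a n) * r ^ n / r"
      using False r by (simp add: \<alpha>_def a'_def norm_mult norm_divide norm_power)
    also have "\<dots> \<le> k * ((real n + 1) / 2) * r ^ n / r"
      using ab(1)[of n] False k r
      by (intro divide_right_mono mult_right_mono mult_left_mono) auto
    finally have \<alpha>: "norm (\<alpha> n) \<le> k * ((real n + 1) / 2) * r ^ n / r" .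
    have "norm (1 - ?l - ?l * cnj \<epsilon> * of_nat n) \<le> norm (of_real (1 - l) :: complex) + norm (?l * cnj \<epsilon> * of_nat n)"
      using norm_triangle_ineq4[of "of_real (1 - l)" "?l * cnj \<epsilon> * of_nat n"] by simp
    also have "\<dots> = k"
      unfolding norm_mult norm_of_real complex_mod_cnj \<epsilon> using l by (simp add: k_def)
    finally have "norm (1 - ?l - ?l * cnj \<epsilon> * of_nat n) \<le> k" .
    moreover have "norm (\<beta> n) = norm (1 - ?l - ?l * cnj \<epsilon> * of_nat n) * norm (b n) * r ^ n / r"
      using False r by (simp add: \<beta>_def b'_def norm_mult norm_divide norm_power)
    ultimately have "norm (\<beta> n) \<le> k * norm (b n) * r ^ n / r"
      using r by (simp only:) (intro divide_right_mono mult_right_mono, auto)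
    also have "\<dots> \<le> k * ((real n - 1) / 2) * r ^ n / r"
      using ab(2)[of n] False k r
      by (intro divide_right_mono mult_right_mono mult_left_mono) auto
    finally have \<beta>: "norm (\<beta> n) \<le> k * ((real n - 1) / 2) * r ^ n / r" .
    have "real n * (norm (\<alpha> n) + norm (\<beta> n))
        \<le> real n * (k * ((real n + 1) / 2) * r ^ n / r + k * ((real n - 1) / 2) * r ^ n / r)"
      using \<alpha> \<beta> by (intro mult_left_mono add_mono) auto
    also have "\<dots> = real n ^ 2 * k * r ^ n / r"
      by (simp add: add_divide_distrib diff_divide_distrib algebra_simps power2_eq_square)
    finally show ?thesis
      using False by (simp add: k_def)
  qed
  have maj: "(\<lambda>n. real n ^ 2 * (1 - l + l * real n) * r ^ n / r - (if n = 1 then 1 else 0))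
      sums (coeff_majorant l r - 1)"
    using r by (intro sums_diff coeff_majorant_sums sums_single[of 1 "\<lambda>_. 1"])
  have summ: "summable (\<lambda>n. real n * (norm (\<alpha> n) + norm (\<beta> n)))"
    by (rule summable_comparison_test'[OF sums_summable[OF maj], of 0]) (use bound in auto)
  have "small_coefficients (\<lambda>z. D_combination l \<epsilon> f (?r * z) / ?r) H G \<alpha> \<beta>
      (\<Sum>n. real n * (norm (\<alpha> n) + norm (\<beta> n)))"
  proof
    show "harmonic_rep (\<lambda>z. D_combination l \<epsilon> f (?r * z) / ?r) H G"
      unfolding H_def G_def using rep r by (intro D_combination_rep) auto
    show "\<alpha> n = 0 \<and> \<beta> n = 0" if "n < 2" for n
      using that by (simp add: \<alpha>_def \<beta>_def a'_def b'_def)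
    show "(\<lambda>n. real n * (norm (\<alpha> n) + norm (\<beta> n))) sums
        (\<Sum>n. real n * (norm (\<alpha> n) + norm (\<beta> n)))"
      using summ by (rule summable_sums)
    have "(\<Sum>n. real n * (norm (\<alpha> n) + norm (\<beta> n))) \<le> coeff_majorant l r - 1"
      by (rule sums_le[OF bound summable_sums[OF summ] maj])
    then show "(\<Sum>n. real n * (norm (\<alpha> n) + norm (\<beta> n))) \<le> 1"
      using r(3) by linarith
  next
    fix z :: complex
    assume z: "norm z < 1"
    define w where "w = ?r * z"
    have "norm w \<le> 1 * norm z"
      unfolding w_def norm_mult using r by (intro mult_right_mono) auto
    then have w: "norm w < 1" using z by simp
    have dh: "(h has_field_derivative deriv h w) (at w)" and dg: "(g has_field_derivative deriv g w) (at w)"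
      using rep w by (auto simp: harmonic_rep_def intro!: holomorphic_derivI[of _ "ball 0 1"])
    have "((\<lambda>w. h w - w) has_field_derivative deriv h w - 1) (at w)"
      by (intro derivative_intros dh)
    from power_series_euler_sums[OF h' this w] power_series_euler_sums[OF g' dg w]
    have Es: "(\<lambda>n. of_nat n * a' n * w ^ n) sums (w * (deriv h w - 1))"
      "(\<lambda>n. of_nat n * b' n * w ^ n) sums (w * deriv g w)" by simp_all
    have "(\<lambda>n. ((1 - ?l) * (a' n * w ^ n) + ?l * (of_nat n * a' n * w ^ n)) / ?r) sums
        (((1 - ?l) * (h w - w) + ?l * (w * (deriv h w - 1))) / ?r)"
      using h'[OF w] Es by (intro sums_divide sums_add sums_mult)
    moreover have "((1 - ?l) * (h w - w) + ?l * (w * (deriv h w - 1))) / ?r = H z - z"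
      using r unfolding H_def w_def[symmetric] by (simp add: w_def field_simps)
    moreover have "((1 - ?l) * (a' n * w ^ n) + ?l * (of_nat n * a' n * w ^ n)) / ?r = \<alpha> n * z ^ n" for n
      by (simp add: \<alpha>_def w_def power_mult_distrib add_divide_distrib algebra_simps)
    ultimately show "(\<lambda>n. \<alpha> n * z ^ n) sums (H z - z)" by simp
    have "(\<lambda>n. ((1 - ?l) * (b' n * w ^ n) - ?l * cnj \<epsilon> * (of_nat n * b' n * w ^ n)) / ?r) sums
        (((1 - ?l) * g w - ?l * cnj \<epsilon> * (w * deriv g w)) / ?r)"
      using g'[OF w] Es by (intro sums_divide sums_diff sums_mult)
    moreover have "((1 - ?l) * (b' n * w ^ n) - ?l * cnj \<epsilon> * (of_nat n * b' n * w ^ n)) / ?r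
        = \<beta> n * z ^ n" for n
      by (simp add: \<beta>_def w_def power_mult_distrib diff_divide_distrib algebra_simps)
    ultimately show "(\<lambda>n. \<beta> n * z ^ n) sums G z"
      by (simp add: G_def w_def)
  qed
  then show ?thesis
    unfolding fully_starlike_in_def by (rule small_coefficients.fully_starlike)
qed

section \<open>Sharpness\<close>

text \<open>The operator \<open>D_op \<epsilon> f\<close> depends on \<open>f\<close> alone; its values for \<open>\<epsilon> = 0\<close> and \<open>\<epsilon> = 1\<close> recover \<open>z h'\<close> and
  \<open>z g'\<close>. So a failure of \<open>|g'| < |h'|\<close> for one decomposition of \<open>f\<close> excludes all others.\<close>

lemma harmonic_rep_deriv_unique:
  assumes "harmonic_rep f h g" "harmonic_rep f h' g'" and z: "z \<in> ball 0 1" "z \<noteq> 0"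
  shows "deriv h z = deriv h' z" and "deriv g z = deriv g' z"
proof -
  have eq: "z * deriv h z - \<epsilon> * cnj (z * deriv g z) = z * deriv h' z - \<epsilon> * cnj (z * deriv g' z)" for \<epsilon>
    using D_op_harmonic_rep[OF assms(1) z(1)] D_op_harmonic_rep[OF assms(2) z(1)] by metis
  have h_eq: "z * deriv h z = z * deriv h' z"
    using eq[of 0] by simp
  then have "cnj (z * deriv g z) = cnj (z * deriv g' z)"
    using eq[of 1] by (simp only: mult_1_left) simp
  with h_eq z(2) show "deriv h z = deriv h' z" "deriv g z = deriv g' z"
    by (simp_all only: complex_cnj_cancel_iff mult_cancel_left) auto
qed

text \<open>The analytic and the co-analytic part with coefficients \<open>-(n + 1)/2\<close> and \<open>(n - 1)/2\<close> for
  \<open>n \<ge> 2\<close>.\<close>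

definition extremal_h :: "complex \<Rightarrow> complex" where
  "extremal_h z = 2 * z + 1 / 2 - 1 / (2 * (1 - z)\<^sup>2)"

definition extremal_g :: "complex \<Rightarrow> complex" where
  "extremal_g z = z\<^sup>2 / (2 * (1 - z)\<^sup>2)"

lemma extremal_rep: "harmonic_rep (\<lambda>z. extremal_h z + cnj (extremal_g z)) extremal_h extremal_g"
proof -
  have nz: "1 - z \<noteq> 0" if "norm z < 1" for z :: complex
    using that by auto
  have "(extremal_h has_field_derivative 1) (at 0)"
    unfolding extremal_h_def by (auto intro!: derivative_eq_intros)
  then have "deriv extremal_h 0 = 1" by (rule DERIV_imp_deriv)
  moreover have "extremal_h holomorphic_on ball 0 1" "extremal_g holomorphic_on ball 0 1"
    unfolding extremal_h_def extremal_g_def using nz by (auto intro!: holomorphic_intros)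
  ultimately show ?thesis
    by (simp add: harmonic_rep_def extremal_h_def extremal_g_def)
qed

lemma extremal_diff:
  assumes "z \<noteq> 1"
  shows "extremal_h z - extremal_g z = 2 * z - z / (1 - z)\<^sup>2"
proof -
  have "1 - z \<noteq> 0" using assms by auto
  then show ?thesis
    by (simp add: extremal_h_def extremal_g_def divide_simps) algebra
qed

lemma extremal_convex_coeff_bounds: "convex_coeff_bounds (\<lambda>z. extremal_h z + cnj (extremal_g z))"
  unfolding convex_coeff_bounds_def
proof (intro exI conjI)
  let ?a = "\<lambda>n. - ((of_nat n + 1) / 2) :: complex" and ?b = "\<lambda>n. (of_nat n - 1) / 2 :: complex"
  show "harmonic_rep (\<lambda>z. extremal_h z + cnj (extremal_g z)) extremal_h extremal_g"
    by (rule extremal_rep)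
  show "\<forall>n\<ge>2. norm (?a n) \<le> (real n + 1) / 2 \<and> norm (?b n) \<le> (real n - 1) / 2"
  proof (intro allI impI conjI)
    fix n :: nat
    assume "2 \<le> n"
    then show "norm (?a n) \<le> (real n + 1) / 2" "norm (?b n) \<le> (real n - 1) / 2"
      using norm_of_nat[of "n + 1", where 'a = complex] norm_of_nat[of "n - 1", where 'a = complex]
      by (simp_all add: norm_divide of_nat_diff add.commute)
  qed
  have "(\<lambda>n. ?a (n + 2) * z ^ (n + 2)) sums (extremal_h z - z)
      \<and> (\<lambda>n. ?b (n + 2) * z ^ (n + 2)) sums extremal_g z" if z: "z \<in> ball 0 1" for z
  proof -
    have nz: "1 - z \<noteq> 0" using z by auto
    have 1: "(\<lambda>n. of_nat n * z ^ n) sums (z / (1 - z)\<^sup>2)" and 2: "(\<lambda>n. z ^ n) sums (1 / (1 - z))"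
      using z by (auto intro: sums_of_nat_powers geometric_sums)
    have "(\<lambda>n. - (of_nat n * z ^ n + z ^ n) / 2) sums (- (z / (1 - z)\<^sup>2 + 1 / (1 - z)) / 2)"
      using 1 2 by (intro sums_divide sums_minus sums_add)
    also have "- (z / (1 - z)\<^sup>2 + 1 / (1 - z)) / 2 = (extremal_h z - z) + (\<Sum>n<2. ?a n * z ^ n)"
      using nz by (simp add: extremal_h_def divide_simps numeral_2_eq_2) algebra
    also have "(\<lambda>n. - (of_nat n * z ^ n + z ^ n) / 2) = (\<lambda>n. ?a n * z ^ n)"
      by (rule ext) (simp add: algebra_simps add_divide_distrib diff_divide_distrib)
    finally have A: "(\<lambda>n. ?a n * z ^ n) sums ((extremal_h z - z) + (\<Sum>n<2. ?a n * z ^ n))" .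
    have "(\<lambda>n. (of_nat n * z ^ n - z ^ n) / 2) sums ((z / (1 - z)\<^sup>2 - 1 / (1 - z)) / 2)"
      using 1 2 by (intro sums_divide sums_diff)
    also have "(z / (1 - z)\<^sup>2 - 1 / (1 - z)) / 2 = extremal_g z + (\<Sum>n<2. ?b n * z ^ n)"
      using nz by (simp add: extremal_g_def divide_simps numeral_2_eq_2) algebra
    also have "(\<lambda>n. (of_nat n * z ^ n - z ^ n) / 2) = (\<lambda>n. ?b n * z ^ n)"
      by (simp add: field_simps)
    finally have B: "(\<lambda>n. ?b n * z ^ n) sums (extremal_g z + (\<Sum>n<2. ?b n * z ^ n))" .
    show ?thesis
      using A B sums_iff_shift[of "\<lambda>n. ?a n * z ^ n" 2] sums_iff_shift[of "\<lambda>n. ?b n * z ^ n" 2]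
      by blast
  qed
  then show "\<forall>z\<in>ball 0 1. (\<lambda>n. ?a (n + 2) * z ^ (n + 2)) sums (extremal_h z - z)"
    "\<forall>z\<in>ball 0 1. (\<lambda>n. ?b (n + 2) * z ^ (n + 2)) sums extremal_g z"
    by blast+
qed

text \<open>The difference of the two parts is \<open>2 z\<close> minus the Koebe function. With \<open>\<epsilon> = -1\<close> the combination acts
  on both parts by the same operator \<open>(1 - l) + l z d/dz\<close>, so \<open>H - G\<close> is the image of that difference
  and its derivative at the critical radius is \<open>2 - coeff_majorant l r = 0\<close>.\<close>

theorem extremal_not_fully_starlike_in:
  assumes r: "0 < r" "r < \<rho>" "\<rho> \<le> 1" and crit: "coeff_majorant l r = 2"
  shows "\<not> fully_starlike_in (D_combination l (-1) (\<lambda>z. extremal_h z + cnj (extremal_g z))) \<rho>"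
proof
  let ?F = "\<lambda>z. D_combination l (-1) (\<lambda>z. extremal_h z + cnj (extremal_g z)) (of_real \<rho> * z) / of_real \<rho>"
  let ?l = "of_real l :: complex" and ?\<rho> = "of_real \<rho> :: complex" and ?r = "of_real r :: complex"
  assume "fully_starlike_in (D_combination l (-1) (\<lambda>z. extremal_h z + cnj (extremal_g z))) \<rho>"
  then obtain h g where hg: "harmonic_rep ?F h g"
    and sense: "\<And>z. z \<in> ball 0 1 \<Longrightarrow> norm (deriv g z) < norm (deriv h z)"
    unfolding fully_starlike_in_def fully_starlike_def class_SH_def by blast
  define H where "H z = ((1 - ?l) * extremal_h (?\<rho> * z)
        + ?l * (?\<rho> * z * deriv extremal_h (?\<rho> * z))) / ?\<rho>" for z
  define G where "G z = ((1 - ?l) * extremal_g (?\<rho> * z)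
        - ?l * cnj (-1) * (?\<rho> * z * deriv extremal_g (?\<rho> * z))) / ?\<rho>" for z
  have HG: "harmonic_rep ?F H G"
    unfolding H_def G_def using r by (intro D_combination_rep extremal_rep) auto
  define z :: complex where "z = of_real (r / \<rho>)"
  have z: "z \<in> ball 0 1" "z \<noteq> 0" and \<rho>z: "?\<rho> * z = ?r"
    using r by (simp_all add: z_def norm_divide)
  have hol: "extremal_h holomorphic_on ball 0 1" "extremal_g holomorphic_on ball 0 1"
    using extremal_rep by (auto simp: harmonic_rep_def)
  have diff': "deriv extremal_h w - deriv extremal_g w = 2 - (1 + w) / (1 - w) ^ 3" if w: "w \<in> ball 0 1" for w
  proof -
    have "w \<noteq> 1" using w by auto
    have "((\<lambda>w. extremal_h w - extremal_g w) has_field_derivative deriv extremal_h w - deriv extremal_g w) (at w)"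
      by (intro derivative_intros holomorphic_derivI[OF _ open_ball w] hol)
    then have "((\<lambda>w. 2 * w - w / (1 - w)\<^sup>2) has_field_derivative deriv extremal_h w - deriv extremal_g w) (at w)"
      by (rule has_field_derivative_transform_within_open[OF _ open_ball w])
        (auto intro: extremal_diff)
    moreover have "((\<lambda>w. 2 * w - w / (1 - w)\<^sup>2) has_field_derivative 2 - (1 + w) / (1 - w) ^ 3) (at w)"
      using DERIV_diff[OF DERIV_cmult_Id koebe_deriv[OF \<open>w \<noteq> 1\<close>], of 2] by simp
    ultimately show ?thesis by (rule DERIV_unique)
  qed
  define K where "K w = (1 - ?l) * (2 * w - w / (1 - w)\<^sup>2)
      + ?l * (2 * w - w * ((1 + w) / (1 - w) ^ 3))" for w
  have HG_eq: "H x - G x = K (?\<rho> * x) / ?\<rho>" if x: "x \<in> ball 0 1" for x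
  proof -
    define w where "w = ?\<rho> * x"
    have "norm w \<le> 1 * norm x"
      unfolding w_def norm_mult using r by (intro mult_right_mono) auto
    then have w: "w \<in> ball 0 1" "w \<noteq> 1" using x by auto
    have "H x - G x = ((1 - ?l) * (extremal_h w - extremal_g w)
        + ?l * (w * (deriv extremal_h w - deriv extremal_g w))) / ?\<rho>"
      using r unfolding H_def G_def w_def[symmetric] by (simp add: field_simps)
    then show ?thesis
      unfolding extremal_diff[OF w(2)] diff'[OF w(1)]
      by (simp add: K_def w_def right_diff_distrib mult.commute)
  qed
  have "?r \<noteq> 1" using r by simp
  have "(K has_field_derivative (1 - ?l) * (2 * 1 - (1 + ?r) / (1 - ?r) ^ 3)
      + ?l * (2 * 1 - (1 + 4 * ?r + ?r\<^sup>2) / (1 - ?r) ^ 4)) (at ?r)"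
    unfolding K_def
    by (intro DERIV_add DERIV_cmult DERIV_diff DERIV_ident
        koebe_deriv koebe_euler_deriv \<open>?r \<noteq> 1\<close>)
  also have "(1 - ?l) * (2 * 1 - (1 + ?r) / (1 - ?r) ^ 3)
      + ?l * (2 * 1 - (1 + 4 * ?r + ?r\<^sup>2) / (1 - ?r) ^ 4) = of_real (2 - coeff_majorant l r)"
    by (simp add: coeff_majorant_def algebra_simps)
  finally have "(K has_field_derivative 0) (at (?\<rho> * z))"
    using crit by (simp add: \<rho>z)
  from DERIV_cdivide[OF DERIV_chain2[OF this DERIV_cmult_Id], of ?\<rho>]
  have "((\<lambda>x. K (?\<rho> * x) / ?\<rho>) has_field_derivative 0) (at z)" by simp
  then have "((\<lambda>x. H x - G x) has_field_derivative 0) (at z)"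
    by (rule has_field_derivative_transform_within_open[OF _ open_ball z(1)]) (simp add: HG_eq)
  moreover have "((\<lambda>x. H x - G x) has_field_derivative deriv H z - deriv G z) (at z)"
    using HG unfolding harmonic_rep_def
    by (intro derivative_intros holomorphic_derivI[OF _ open_ball z(1)]) auto
  ultimately have "deriv H z - deriv G z = 0"
    by (rule DERIV_unique[rotated])
  then have "deriv h z = deriv g z"
    using harmonic_rep_deriv_unique[OF hg HG z] by simp
  then show False
    using sense[OF z(1)] by simp
qed

theorem corollary3p5:
  fixes l :: real
  assumes "0 \<le> l" and "l \<le> 1"
  shows "\<exists>rc::real.
     {r \<in> {0<..<1}. 1 - 4 * (2 + l) * r + (13 - 2 * l) * r ^ 2 - 8 * r ^ 3 + 2 * r ^ 4 = 0} = {rc} \<and>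
     (\<forall>f \<epsilon>. convex_coeff_bounds f \<and> norm \<epsilon> = 1 \<longrightarrow>
        fully_starlike_in (D_combination l \<epsilon> f) rc) \<and>
     (\<forall>\<rho>. rc < \<rho> \<and> \<rho> \<le> 1 \<longrightarrow>
        (\<exists>f \<epsilon>. convex_coeff_bounds f \<and> norm \<epsilon> = 1 \<and>
           \<not> fully_starlike_in (D_combination l \<epsilon> f) \<rho>))"
proof -
  let ?p = "\<lambda>r. 1 - 4 * (2 + l) * r + (13 - 2 * l) * r ^ 2 - 8 * r ^ 3 + 2 * r ^ 4"
  have root_iff: "?p r = 0 \<longleftrightarrow> coeff_majorant l r = 2" if "r < 1" for r
    using that quartic_eq[OF that, of l] by auto
  have "?p (1 / 2) \<le> 0" "0 \<le> ?p 0"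
    using assms by (simp_all add: field_simps power_divide)
  moreover have "continuous_on {0..1 / 2} ?p"
    by (intro continuous_intros)
  ultimately have "\<exists>rc\<ge>0. rc \<le> 1 / 2 \<and> ?p rc = 0"
    by (intro IVT2') simp_all
  then obtain rc where rc: "0 \<le> rc" "rc \<le> 1 / 2" "?p rc = 0"
    by blast
  have "rc \<noteq> 0" using rc(3) by auto
  with rc have rc01: "0 < rc" "rc < 1" by auto
  have crit: "coeff_majorant l rc = 2"
    using rc root_iff[of rc] by simp
  have "{r \<in> {0<..<1}. ?p r = 0} = {rc}"
  proof (intro equalityI subsetI)
    fix r
    assume "r \<in> {r \<in> {0<..<1}. ?p r = 0}"
    then have r: "0 < r" "r < 1" "coeff_majorant l r = 2"
      using root_iff by auto
    then show "r \<in> {rc}"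
      using coeff_majorant_strict_mono[OF assms, of r rc] coeff_majorant_strict_mono[OF assms, of rc r]
        rc01 crit by (cases r rc rule: linorder_cases) auto
  qed (use rc rc01 in auto)
  moreover have "fully_starlike_in (D_combination l \<epsilon> f) rc"
    if "convex_coeff_bounds f" "norm \<epsilon> = 1" for f \<epsilon>
    using fully_starlike_in_D_combination[OF that assms rc01] crit by simp
  moreover have "\<exists>f \<epsilon>. convex_coeff_bounds f \<and> norm \<epsilon> = 1 \<and>
      \<not> fully_starlike_in (D_combination l \<epsilon> f) \<rho>" if "rc < \<rho>" "\<rho> \<le> 1" for \<rho>
    using extremal_convex_coeff_bounds extremal_not_fully_starlike_in[OF rc01(1) that crit]
    by (intro exI[of _ "\<lambda>z. extremal_h z + cnj (extremal_g z)"] exI[of _ "-1"]) simp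
  ultimately show ?thesis by blast
qed

end
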